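(* Let $m\in\mathbb{N}$ and $\boldsymbol{\sigma}=(\sigma_1,\dots,\sigma_m)\in\{0,1\}^m$. Let $\mathcal{H}_m^{\mathrm{sym}}(\boldsymbol{\sigma})$ be the symmetrized Hammersley point set defined in the context, which has $N=2^{m+1}$ points. Then $$ \left(2^{m+1}L_2(\mathcal{H}_m^{\mathrm{sym}}(\boldsymbol{\sigma}))\right)^2=\frac{m}{24}+\frac{11}{8}+\frac{1}{2^{m}}-\frac{1}{9\cdot 2^{2m+1}}, $$ equivalently, in terms of $N=2^{m+1}$, $$ L_2(\mathcal{H}_m^{\mathrm{sym}}(\boldsymbol{\sigma}))=\frac{1}{N}\left(\frac{\log{N}}{24\log{2}}+\frac{4}{3}+\frac{2}{N}-\frac{2}{9N^2}\right)^{1/2}, $$ where $\log$ is the natural logarithm. In particular this value does not depend on $\boldsymbol{\sigma}$.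
   Context: For an $N$-element point set (multiset) $\mathcal{P}=\{\boldsymbol{x}_0,\dots,\boldsymbol{x}_{N-1}\}$ in $[0,1)^2$ and $\alpha,\beta\in(0,1]$, the local discrepancy is $\Delta(\alpha,\beta,\mathcal{P})=A([0,\alpha)\times[0,\beta),\mathcal{P})-N\alpha\beta$, where $A([0,\alpha)\times[0,\beta),\mathcal{P})$ is the number of indices $0\le n\le N-1$ with $\boldsymbol{x}_n\in[0,\alpha)\times[0,\beta)$. The $L_2$ discrepancy is $L_2(\mathcal{P})=\frac1N\left(\int_0^1\int_0^1|\Delta(\alpha,\beta,\mathcal{P})|^2\,d\alpha\,d\beta\right)^{1/2}$. For $\boldsymbol{\sigma}\in\{0,1\}^m$ the shifted Hammersley point set is $$\mathcal{H}_m(\boldsymbol{\sigma})=\left\{\left(\frac{t_m}{2}+\frac{t_{m-1}}{2^2}+\dots+\frac{t_1}{2^m},\ \frac{s_1}{2}+\frac{s_2}{2^2}+\dots+\frac{s_m}{2^m}\right): t_1,\dots,t_m\in\{0,1\}\right\},$$ where $s_j=t_j\oplus\sigma_j$ ($\oplus$ is addition modulo 2); it has $2^m$ points. Let $\boldsymbol{\sigma}^*=(\sigma_1\oplus1,\dots,\sigma_m\oplus1)$ and $\mathcal{H}_m^{\mathrm{sym}}(\boldsymbol{\sigma})=\mathcal{H}_m(\boldsymbol{\sigma})\cup\mathcal{H}_m(\boldsymbol{\sigma}^* )$, a set of $2^{m+1}$ points. *)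

theory Defs
  imports "HOL-Analysis.Analysis" "HOL-Library.Multiset" "HOL-Library.FuncSet"
begin

definition count_box :: "real \<Rightarrow> real \<Rightarrow> (real \<times> real) multiset \<Rightarrow> nat" where
  "count_box \<alpha> \<beta> P = size (filter_mset (\<lambda>(x, y). 0 \<le> x \<and> x < \<alpha> \<and> 0 \<le> y \<and> y < \<beta>) P)"

definition local_discrepancy :: "real \<Rightarrow> real \<Rightarrow> (real \<times> real) multiset \<Rightarrow> real" where
  "local_discrepancy \<alpha> \<beta> P = real (count_box \<alpha> \<beta> P) - real (size P) * \<alpha> * \<beta>"

definition L2_discrepancy :: "(real \<times> real) multiset \<Rightarrow> real" where
  "L2_discrepancy P = (1 / real (size P)) *
     sqrt (integral (cbox (0, 0) (1, 1)) (\<lambda>(\<alpha>, \<beta>). \<bar>local_discrepancy \<alpha> \<beta> P\<bar> ^ 2))"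

text \<open>Shifted Hammersley point set; digits t, sigma are functions on {1..m} with values in {0,1}.\<close>

definition hammersley_point :: "nat \<Rightarrow> (nat \<Rightarrow> nat) \<Rightarrow> (nat \<Rightarrow> nat) \<Rightarrow> real \<times> real" where
  "hammersley_point m \<sigma> t =
     ((\<Sum>j=1..m. real (t j) / 2 ^ (m - j + 1)),
      (\<Sum>j=1..m. real ((t j + \<sigma> j) mod 2) / 2 ^ j))"

definition hammersley :: "nat \<Rightarrow> (nat \<Rightarrow> nat) \<Rightarrow> (real \<times> real) multiset" where
  "hammersley m \<sigma> = image_mset (hammersley_point m \<sigma>) (mset_set (PiE {1..m} (\<lambda>_. {0, 1})))"

definition sigma_star :: "(nat \<Rightarrow> nat) \<Rightarrow> nat \<Rightarrow> nat" where
  "sigma_star \<sigma> j = (\<sigma> j + 1) mod 2"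

definition hammersley_sym :: "nat \<Rightarrow> (nat \<Rightarrow> nat) \<Rightarrow> (real \<times> real) multiset" where
  "hammersley_sym m \<sigma> = hammersley m \<sigma> + hammersley m (sigma_star \<sigma>)"

end

theory Submission
  imports Defs
begin

text \<open>
  By Warnock's formula the squared $L_2$ norm of the local discrepancy is a combination of
  $\sum \max(x,x')\max(y,y')$ over pairs of points and of $\sum (1-x^2)(1-y^2)$ over points.
  Each ordinate $k/M$ with $M = 2^m$ carries two points, with abscissae symmetric about
  $(1-1/M)/2$ at distance $|W_k|/(2M)$. Since
  $\max(v,w)+\max(v,-w)+\max(-v,w)+\max(-v,-w) = 2\max(|v|,|w|)$, the pair sum depends only on
  $\sum_{k,l} \max(|W_k|,|W_l|)\max(k,l)$. The recursion $W^{(m+1)}_{2k+b} = W^{(m)}_k \pm 2^m$ gives closed forms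
  for all sums that occur. With $t = \sum_j (-1)^{\sigma_j}$ the double sum contributes
  $m/24 + (t^2-m)/16$ and the sum $\sum_k k^2 W_k^2$ contributes $-(t^2-m)/16$, so the dependence on
  $\sigma$ cancels.
\<close>

section \<open>Warnock's formula for the integral of the squared local discrepancy\<close>

text \<open>Expanding the square of the local discrepancy produces only integrands of this kind,
  with \<open>p\<close> = 0, 1, 2. The integral factors by Fubini on the box from (a, b) to (1, 1),
  followed by extension by zero.\<close>

lemma has_integral_power_product:
  fixes a b :: real
  assumes "0 \<le> a" "a \<le> 1" "0 \<le> b" "b \<le> 1"
  shows "((\<lambda>(\<alpha>, \<beta>). if a < \<alpha> \<and> b < \<beta> then (\<alpha> * \<beta>) ^ p else 0) has_integral
    (1 - a ^ Suc p) / (p + 1) * ((1 - b ^ Suc p) / (p + 1))) (cbox (0, 0) (1, 1))"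
proof -
  have one_dim: "integral (cbox c 1) (\<lambda>t. t ^ p) = (1 - c ^ Suc p) / (p + 1)" if "c \<le> 1" for c :: real
  proof (rule integral_unique)
    have "((\<lambda>t. t ^ p) has_integral (1 ^ Suc p / (p + 1) - c ^ Suc p / (p + 1))) {c..1}"
      by (rule fundamental_theorem_of_calculus[OF that])
        (auto intro!: derivative_eq_intros simp flip: has_real_derivative_iff_has_vector_derivative simp del: of_nat_Suc power_Suc)
    then show "((\<lambda>t. t ^ p) has_integral (1 - c ^ Suc p) / (p + 1)) (cbox c 1)"
      by (simp add: diff_divide_distrib)
  qed
  let ?f = "\<lambda>(\<alpha>::real, \<beta>::real). (\<alpha> * \<beta>) ^ p"
  have cont: "continuous_on (cbox (a, b) (1, 1)) ?f"
    by (auto simp: case_prod_beta intro!: continuous_intros)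
  have "integral (cbox (a, b) (1, 1)) ?f
      = integral (cbox a 1) (\<lambda>\<alpha>. integral (cbox b 1) (\<lambda>\<beta>. (\<alpha> * \<beta>) ^ p))"
    using integral_prod_continuous[OF cont] by simp
  also have "\<dots> = (1 - a ^ Suc p) / (p + 1) * ((1 - b ^ Suc p) / (p + 1))"
    using assms by (simp add: power_mult_distrib one_dim[unfolded box_real] del: power_Suc)
  finally have "(?f has_integral (1 - a ^ Suc p) / (p + 1) * ((1 - b ^ Suc p) / (p + 1))) (cbox (a, b) (1, 1))"
    using integrable_continuous[OF cont] by (metis integrable_integral)
  then have "((\<lambda>x. if x \<in> box (a, b) (1, 1) then ?f x else 0) has_integral
      (1 - a ^ Suc p) / (p + 1) * ((1 - b ^ Suc p) / (p + 1))) (cbox (0, 0) (1, 1))"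
    by (rule has_integral_restrict_open_subinterval) (use assms in \<open>auto simp: cbox_Pair_eq\<close>)
  \<comment> \<open>Inside the open unit square, lying in the open box above (a, b) means just a <
    \<alpha> and b < \<beta>; the boundary does not affect the integral.\<close>
  then show ?thesis
    by (rule has_integral_spike_interior) (auto simp: box_def Basis_prod_def)
qed

lemma has_integral_sum_mset:
  fixes f :: "'a \<Rightarrow> 'b::euclidean_space \<Rightarrow> 'c::real_normed_vector"
  assumes "\<And>i. i \<in># I \<Longrightarrow> (f i has_integral g i) S"
  shows "((\<lambda>x. \<Sum>i\<in>#I. f i x) has_integral (\<Sum>i\<in>#I. g i)) S"
  using assms by (induction I) (auto intro: has_integral_add)

lemma count_box_eq_sum_mset:
  assumes "\<And>x y. (x, y) \<in># P \<Longrightarrow> 0 \<le> x \<and> 0 \<le> y"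
  shows "real (count_box \<alpha> \<beta> P) = (\<Sum>z\<in>#P. of_bool (fst z < \<alpha> \<and> snd z < \<beta>))"
  using assms by (induction P) (fastforce simp: count_box_def)+

text \<open>The box indicators of z and w multiply to the indicator that \<alpha> and \<beta> exceed
  the coordinatewise maxima of z and w, which integrates to the product of the factors 1 - max. The
  cross term -2N carries a factor 1/4 and the square of N\<alpha>\<beta> integrates to
  N^2/9.\<close>

lemma warnock:
  fixes P :: "(real \<times> real) multiset"
  assumes P: "\<And>x y. (x, y) \<in># P \<Longrightarrow> 0 \<le> x \<and> x \<le> 1 \<and> 0 \<le> y \<and> y \<le> 1"
  shows "integral (cbox (0, 0) (1, 1)) (\<lambda>(\<alpha>, \<beta>). \<bar>local_discrepancy \<alpha> \<beta> P\<bar> ^ 2) =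
    (\<Sum>z\<in>#P. \<Sum>w\<in>#P. (1 - max (fst z) (fst w)) * (1 - max (snd z) (snd w)))
    - real (size P) / 2 * (\<Sum>z\<in>#P. (1 - (fst z)\<^sup>2) * (1 - (snd z)\<^sup>2)) + (real (size P))\<^sup>2 / 9"
proof (rule integral_unique)
  define N where "N = real (size P)"
  define K where "K a b p = (\<lambda>(\<alpha>::real, \<beta>::real). if a < \<alpha> \<and> b < \<beta> then (\<alpha> * \<beta>) ^ p else 0)" for a b :: real and p
  define D where "D x = (\<Sum>z\<in>#P. \<Sum>w\<in>#P. K (max (fst z) (fst w)) (max (snd z) (snd w)) 0 x)
      - 2 * N * (\<Sum>z\<in>#P. K (fst z) (snd z) 1 x) + N\<^sup>2 * K 0 0 2 x" for x
  have bounds: "0 \<le> fst z \<and> fst z \<le> 1 \<and> 0 \<le> snd z \<and> snd z \<le> 1" if "z \<in># P" for z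
    using P[of "fst z" "snd z"] that by simp
  have K0: "(K a b 0 has_integral (1 - a) * (1 - b)) (cbox (0, 0) (1, 1))"
    and K1: "(K a b 1 has_integral (1 - a\<^sup>2) * (1 - b\<^sup>2) / 4) (cbox (0, 0) (1, 1))"
    and K2: "(K a b 2 has_integral (1 - a^3) * (1 - b^3) / 9) (cbox (0, 0) (1, 1))"
    if "0 \<le> a" "a \<le> 1" "0 \<le> b" "b \<le> 1" for a b
    using has_integral_power_product[OF that, of 0] has_integral_power_product[OF that, of 1]
      has_integral_power_product[OF that, of 2]
    unfolding K_def by (simp_all add: power2_eq_square power3_eq_cube)
  have K2': "(K 0 0 2 has_integral 1 / 9) (cbox (0, 0) (1, 1))"
    using K2[of 0 0] by simp
  have K1s: "((\<lambda>x. \<Sum>z\<in>#P. K (fst z) (snd z) 1 x) has_integral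
      (\<Sum>z\<in>#P. (1 - (fst z)\<^sup>2) * (1 - (snd z)\<^sup>2) / 4)) (cbox (0, 0) (1, 1))"
    using bounds by (intro has_integral_sum_mset K1) blast+
  have K0s: "((\<lambda>x. \<Sum>z\<in>#P. \<Sum>w\<in>#P. K (max (fst z) (fst w)) (max (snd z) (snd w)) 0 x) has_integral
      (\<Sum>z\<in>#P. \<Sum>w\<in>#P. (1 - max (fst z) (fst w)) * (1 - max (snd z) (snd w)))) (cbox (0, 0) (1, 1))"
    by (intro has_integral_sum_mset K0) (use bounds in \<open>auto simp: max_def\<close>)
  have div4: "(\<Sum>z\<in>#P. (1 - (fst z)\<^sup>2) * (1 - (snd z)\<^sup>2) / 4) = (\<Sum>z\<in>#P. (1 - (fst z)\<^sup>2) * (1 - (snd z)\<^sup>2)) / 4"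
    by (induction P) (simp_all add: add_divide_distrib)
  have "(D has_integral
      (\<Sum>z\<in>#P. \<Sum>w\<in>#P. (1 - max (fst z) (fst w)) * (1 - max (snd z) (snd w)))
      - 2 * N * ((\<Sum>z\<in>#P. (1 - (fst z)\<^sup>2) * (1 - (snd z)\<^sup>2)) / 4) + N\<^sup>2 * (1 / 9)) (cbox (0, 0) (1, 1))"
    unfolding D_def
    by (intro has_integral_add has_integral_diff has_integral_mult_right K0s K1s[unfolded div4] K2')
  also have "2 * N * ((\<Sum>z\<in>#P. (1 - (fst z)\<^sup>2) * (1 - (snd z)\<^sup>2)) / 4) = N / 2 * (\<Sum>z\<in>#P. (1 - (fst z)\<^sup>2) * (1 - (snd z)\<^sup>2))"
    by simp
  finally have int: "(D has_integral
      (\<Sum>z\<in>#P. \<Sum>w\<in>#P. (1 - max (fst z) (fst w)) * (1 - max (snd z) (snd w)))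
      - N / 2 * (\<Sum>z\<in>#P. (1 - (fst z)\<^sup>2) * (1 - (snd z)\<^sup>2)) + N\<^sup>2 / 9) (cbox (0, 0) (1, 1))"
    by simp
  \<comment> \<open>Agreement on the open square is enough for the integral; there both coordinates
    are positive, so the condition in \<open>K 0 0 2\<close> is met.\<close>
  have "(\<lambda>(\<alpha>, \<beta>). \<bar>local_discrepancy \<alpha> \<beta> P\<bar> ^ 2) x = D x" if "x \<in> box (0, 0) (1, 1)" for x
  proof -
    obtain \<alpha> \<beta> where x: "x = (\<alpha>, \<beta>)" by (cases x)
    with that have pos: "0 < \<alpha>" "0 < \<beta>"
      by (auto simp: box_def Basis_prod_def)
    define c where "c z = (of_bool (fst z < \<alpha> \<and> snd z < \<beta>) :: real)" for z
    have "real (count_box \<alpha> \<beta> P) = (\<Sum>z\<in>#P. c z)"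
      unfolding c_def using P by (intro count_box_eq_sum_mset) blast
    then have "\<bar>local_discrepancy \<alpha> \<beta> P\<bar> ^ 2 = ((\<Sum>z\<in>#P. c z) - N * \<alpha> * \<beta>)\<^sup>2"
      by (simp add: local_discrepancy_def N_def)
    also have "\<dots> = (\<Sum>z\<in>#P. c z) * (\<Sum>w\<in>#P. c w) - 2 * N * ((\<Sum>z\<in>#P. c z) * (\<alpha> * \<beta>)) + N\<^sup>2 * (\<alpha> * \<beta>)\<^sup>2"
      by (simp add: power2_eq_square algebra_simps)
    also have "(\<Sum>z\<in>#P. c z) * (\<Sum>w\<in>#P. c w) = (\<Sum>z\<in>#P. \<Sum>w\<in>#P. c z * c w)"
      by (simp add: sum_mset_distrib_left sum_mset_distrib_right mult.commute)
    also have "(\<lambda>z w. c z * c w) = (\<lambda>z w. K (max (fst z) (fst w)) (max (snd z) (snd w)) 0 x)"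
      by (auto simp: fun_eq_iff c_def K_def x)
    also have "(\<Sum>z\<in>#P. c z) * (\<alpha> * \<beta>) = (\<Sum>z\<in>#P. c z * (\<alpha> * \<beta>))"
      by (simp add: sum_mset_distrib_right)
    also have "(\<lambda>z. c z * (\<alpha> * \<beta>)) = (\<lambda>z. K (fst z) (snd z) 1 x)"
      by (auto simp: fun_eq_iff c_def K_def x)
    also have "(\<alpha> * \<beta>)\<^sup>2 = K 0 0 2 x" using pos by (simp add: K_def x)
    finally show ?thesis by (simp add: D_def x)
  qed
  then show "((\<lambda>(\<alpha>, \<beta>). \<bar>local_discrepancy \<alpha> \<beta> P\<bar> ^ 2) has_integral 
      (\<Sum>z\<in>#P. \<Sum>w\<in>#P. (1 - max (fst z) (fst w)) * (1 - max (snd z) (snd w)))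
      - real (size P) / 2 * (\<Sum>z\<in>#P. (1 - (fst z)\<^sup>2) * (1 - (snd z)\<^sup>2)) + (real (size P))\<^sup>2 / 9)
      (cbox (0, 0) (1, 1))"
    using has_integral_spike_interior[OF int] unfolding N_def by blast
qed

section \<open>Sums over index ranges and over pairs of indices\<close>

text \<open>Appending a last binary digit turns the index k into its children 2k and 2k+1; the
  inductions on \<open>m\<close> for the sums over offsets rest on this split.\<close>

lemma sum_lessThan_double:
  fixes f :: "nat \<Rightarrow> 'a::comm_monoid_add"
  shows "(\<Sum>k<2 * n. f k) = (\<Sum>k<n. f (2 * k) + f (2 * k + 1))"
  by (induction n) (simp_all add: ac_simps)

lemma sum_sum_lessThan_double:
  fixes f :: "nat \<Rightarrow> nat \<Rightarrow> 'a::comm_monoid_add"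
  shows "(\<Sum>k<2 * n. \<Sum>l<2 * n. f k l) =
    (\<Sum>k<n. \<Sum>l<n. f (2 * k) (2 * l) + f (2 * k) (2 * l + 1)
      + f (2 * k + 1) (2 * l) + f (2 * k + 1) (2 * l + 1))"
  unfolding sum_lessThan_double sum.distrib by (simp add: ac_simps)

text \<open>Exactly 2k+1 pairs of indices have maximum k.\<close>

lemma sum_sum_at_max:
  fixes f :: "nat \<Rightarrow> real"
  shows "(\<Sum>k<n. \<Sum>l<n. f (max k l)) = (\<Sum>k<n. (2 * real k + 1) * f k)"
proof (induction n)
  case (Suc n)
  have "(\<Sum>k<Suc n. \<Sum>l<Suc n. f (max k l))
      = (\<Sum>k<n. (\<Sum>l<n. f (max k l)) + f (max k n)) + ((\<Sum>l<n. f (max n l)) + f n)"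
    by simp
  also have "(\<Sum>l<n. f (max n l)) = real n * f n" by simp
  also have "(\<Sum>k<n. (\<Sum>l<n. f (max k l)) + f (max k n)) 
     = (\<Sum>k<n. \<Sum>l<n. f (max k l)) + real n * f n"
    by (simp add: sum.distrib)
  finally show ?case using Suc.IH by (simp add: algebra_simps)
qed simp

lemma sum_nat: "(\<Sum>k<n. real k) = real n * (real n - 1) / 2"
  by (induction n) (auto simp: field_simps)

lemma sum_nat_squares: "(\<Sum>k<n. real k ^ 2) = real n * (real n - 1) * (2 * real n - 1) / 6"
  by (induction n) (auto simp: field_simps power2_eq_square)

lemma sum_max_index:
  "(\<Sum>k<n. \<Sum>l<n. real (max k l)) = real n * (real n - 1) * (4 * real n + 1) / 6"
proof -
  have "(\<Sum>k<n. (2 * real k + 1) * real k) = (\<Sum>k<n. 2 * (real k)\<^sup>2 + real k)"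
    by (simp add: algebra_simps power2_eq_square)
  also have "\<dots> = 2 * (real n * (real n - 1) * (2 * real n - 1) / 6) + real n * (real n - 1) / 2"
    unfolding sum.distrib sum_distrib_left[symmetric] sum_nat sum_nat_squares ..
  finally show ?thesis unfolding sum_sum_at_max by (simp add: field_simps)
qed

section \<open>Centred abscissae and their recursion\<close>

text \<open>The number $W_k$: twice the centred abscissa of the point of ordinate $k/2^m$, in units of $2^{-m}$.\<close>

primrec offset :: "(nat \<Rightarrow> nat) \<Rightarrow> nat \<Rightarrow> nat \<Rightarrow> real" where
  "offset \<sigma> 0 k = 0"
| "offset \<sigma> (Suc m) k = offset \<sigma> m (k div 2) - (-1) ^ (k + \<sigma> (Suc m)) * 2 ^ m"

lemma offset_even: "offset \<sigma> (Suc m) (2 * k) = offset \<sigma> m k - (-1) ^ \<sigma> (Suc m) * 2 ^ m"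
  and offset_odd: "offset \<sigma> (Suc m) (2 * k + 1) = offset \<sigma> m k + (-1) ^ \<sigma> (Suc m) * 2 ^ m"
  by (simp_all add: power_add)

text \<open>Complementing the shift flips every sign in the recursion, so the two points on one
  ordinate are mirror images about the centre.\<close>

lemma offset_sigma_star: "offset (sigma_star \<sigma>) m k = - offset \<sigma> m k"
proof (induction m arbitrary: k)
  case (Suc m)
  have "(-1::real) ^ sigma_star \<sigma> (Suc m) = - ((-1) ^ \<sigma> (Suc m))"
    by (cases "even (\<sigma> (Suc m))") (auto simp: sigma_star_def even_iff_mod_2_eq_zero mod_Suc odd_iff_mod_2_eq_one)
  then show ?case using Suc by (simp add: power_add)
qed simp

lemma abs_offset_le: "\<bar>offset \<sigma> m k\<bar> \<le> 2 ^ m - 1"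
proof (induction m arbitrary: k)
  case (Suc m)
  have "\<bar>offset \<sigma> (Suc m) k\<bar> \<le> \<bar>offset \<sigma> m (k div 2)\<bar> + \<bar>(-1) ^ (k + \<sigma> (Suc m)) * 2 ^ m\<bar>"
    unfolding offset.simps by (rule abs_triangle_ineq4)
  also have "\<dots> \<le> (2 ^ m - 1) + 2 ^ m"
    using Suc[of "k div 2"] by (simp add: abs_mult power_abs)
  finally show ?case by simp
qed simp

text \<open>The summand of size M dominates w and fixes the sign, so absolute values at the child
  level become affine in the signed parent offset.\<close>

lemma offset_child_abs:
  fixes t M w :: real
  assumes "t = 1 \<or> t = -1" "\<bar>w\<bar> \<le> M"
  shows "\<bar>w - t * M\<bar> = M - t * w" "\<bar>w + t * M\<bar> = M + t * w"
  using assms by auto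

lemma abs_offset_even: "\<bar>offset \<sigma> (Suc m) (2 * k)\<bar> = 2 ^ m - (-1) ^ \<sigma> (Suc m) * offset \<sigma> m k"
  and abs_offset_odd: "\<bar>offset \<sigma> (Suc m) (2 * k + 1)\<bar> = 2 ^ m + (-1) ^ \<sigma> (Suc m) * offset \<sigma> m k"
proof -
  have 1: "(-1::real) ^ \<sigma> (Suc m) = 1 \<or> (-1::real) ^ \<sigma> (Suc m) = -1"
    by (cases "even (\<sigma> (Suc m))") auto
  have 2: "\<bar>offset \<sigma> m k\<bar> \<le> 2 ^ m" using abs_offset_le[of \<sigma> m k] by linarith
  show "\<bar>offset \<sigma> (Suc m) (2 * k)\<bar> = 2 ^ m - (-1) ^ \<sigma> (Suc m) * offset \<sigma> m k"
    unfolding offset_even by (rule offset_child_abs[OF 1 2])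
  show "\<bar>offset \<sigma> (Suc m) (2 * k + 1)\<bar> = 2 ^ m + (-1) ^ \<sigma> (Suc m) * offset \<sigma> m k"
    unfolding offset_odd by (rule offset_child_abs[OF 1 2])
qed

section \<open>The Hammersley set indexed by ordinates\<close>

lemma mset_set_PiE_Suc:
  fixes m :: nat
  shows "mset_set (PiE {1..Suc m} (\<lambda>_. {0, 1::nat})) =
    image_mset (\<lambda>t. t(Suc m := 0)) (mset_set (PiE {1..m} (\<lambda>_. {0, 1})))
    + image_mset (\<lambda>t. t(Suc m := 1)) (mset_set (PiE {1..m} (\<lambda>_. {0, 1})))"
proof -
  let ?T = "PiE {1..m} (\<lambda>_. {0, 1::nat})"
  \<comment> \<open>Members of \<open>?T\<close> are \<open>undefined\<close> outside {1..m}, so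
    they already agree at \<open>Suc m\<close> and overwriting that value loses nothing.\<close>
  have inj: "inj_on (\<lambda>t. t(Suc m := e)) ?T" for e
  proof (rule inj_onI)
    fix s t :: "nat \<Rightarrow> nat"
    assume st: "s \<in> ?T" "t \<in> ?T" and eq: "s(Suc m := e) = t(Suc m := e)"
    show "s = t"
    proof
      fix j
      show "s j = t j"
      proof (cases "j = Suc m")
        case True
        then have "j \<notin> {1..m}" by simp
        then show ?thesis using PiE_arb[OF st(1)] PiE_arb[OF st(2)] by simp
      next
        case False
        then show ?thesis using fun_cong[OF eq, of j] by simp
      qed
    qed
  qed
  have "{1..Suc m} = insert (Suc m) {1..m}"
    by (rule atLeastAtMostSuc_conv) simp
  then have "PiE {1..Suc m} (\<lambda>_. {0, 1}) = (\<lambda>t. t(Suc m := 0)) ` ?T \<union> (\<lambda>t. t(Suc m := 1)) ` ?T"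
    by (simp only: PiE_insert_eq) auto
  moreover have "(\<lambda>t. t(Suc m := 0)) ` ?T \<inter> (\<lambda>t. t(Suc m := 1)) ` ?T = {}"
    by (auto dest: fun_cong[where x = "Suc m"])
  ultimately show ?thesis
    by (simp add: mset_set_Union finite_PiE image_mset_mset_set[OF inj] del: One_nat_def)
qed

lemma mset_set_lessThan_double:
  "mset_set {..<2 * n} = image_mset (\<lambda>k. 2 * k) (mset_set {..<n}) + image_mset (\<lambda>k. 2 * k + 1) (mset_set {..<n})"
  for n :: nat
  by (induction n) (simp_all add: lessThan_Suc)

text \<open>The new digit is the leading one of the abscissa and, after the shift, the last one of
  the ordinate.\<close>

lemma hammersley_point_update:
  "hammersley_point (Suc m) \<sigma> (t(Suc m := e)) =
    ((real e + fst (hammersley_point m \<sigma> t)) / 2,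
     snd (hammersley_point m \<sigma> t) + real ((e + \<sigma> (Suc m)) mod 2) / 2 ^ Suc m)"
proof -
  have "(\<Sum>j=1..m. real (t j) / 2 ^ (Suc m - j + 1)) = (\<Sum>j=1..m. real (t j) / 2 ^ (m - j + 1)) / 2"
    unfolding sum_divide_distrib by (rule sum.cong) (auto simp: Suc_diff_le)
  then show ?thesis
    by (simp add: hammersley_point_def add_divide_distrib)
qed

lemma hammersley_Suc:
  "hammersley (Suc m) \<sigma> =
    image_mset (\<lambda>(x, y). (x / 2, y + real (\<sigma> (Suc m) mod 2) / 2 ^ Suc m)) (hammersley m \<sigma>)
    + image_mset (\<lambda>(x, y). ((1 + x) / 2, y + real ((1 + \<sigma> (Suc m)) mod 2) / 2 ^ Suc m)) (hammersley m \<sigma>)"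
  unfolding hammersley_def mset_set_PiE_Suc
  by (simp add: image_mset.compositionality comp_def hammersley_point_update case_prod_beta)

definition offset_point :: "(nat \<Rightarrow> nat) \<Rightarrow> nat \<Rightarrow> nat \<Rightarrow> real \<times> real" where
  "offset_point \<sigma> m k = ((1 - 1 / 2 ^ m) / 2 + offset \<sigma> m k / (2 * 2 ^ m), real k / 2 ^ m)"

text \<open>If the last ordinate digit is b, the new abscissa digit is e = b + \<sigma> (Suc m) mod
  2. With M = 2^m, passing from x to (e+x)/2 changes the centred abscissa from W/(2M) to (W+M)/(4M)
  if e = 1 and to (W-M)/(4M) if e = 0, which is the recursion of \<open>offset\<close>.\<close>

lemma hammersley_eq_offset:
  "hammersley m \<sigma> = image_mset (offset_point \<sigma> m) (mset_set {..<2 ^ m})"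
proof (induction m)
  case 0
  show ?case
    by (simp add: hammersley_def hammersley_point_def offset_point_def lessThan_Suc)
next
  case (Suc m)
  let ?g = "\<lambda>e (x, y). ((real e + x) / 2, y + real ((e + \<sigma> (Suc m)) mod 2) / 2 ^ Suc m)"
  have split: "image_mset (offset_point \<sigma> (Suc m)) (mset_set {..<2 ^ Suc m}) =
      image_mset (\<lambda>k. offset_point \<sigma> (Suc m) (2 * k)) (mset_set {..<2 ^ m})
      + image_mset (\<lambda>k. offset_point \<sigma> (Suc m) (2 * k + 1)) (mset_set {..<2 ^ m})"
    unfolding power_Suc mset_set_lessThan_double by (simp add: image_mset.compositionality comp_def)
  show ?case
  \<comment> \<open>The parity decides which of the children 2k and 2k+1 carries the digit 0; in the
    odd case the two halves of the multiset are exchanged.\<close>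
  proof (cases "even (\<sigma> (Suc m))")
    case True
    have "offset_point \<sigma> (Suc m) (2 * k) = ?g 0 (offset_point \<sigma> m k)"
      and "offset_point \<sigma> (Suc m) (2 * k + 1) = ?g 1 (offset_point \<sigma> m k)" for k
      unfolding offset_point_def offset_even offset_odd
      using True by (simp_all add: field_simps even_iff_mod_2_eq_zero mod_Suc)
    then show ?thesis
      unfolding split unfolding hammersley_Suc Suc
      by (simp add: image_mset.compositionality comp_def del: power_Suc)
  next
    case False
    have "offset_point \<sigma> (Suc m) (2 * k) = ?g 1 (offset_point \<sigma> m k)"
      and "offset_point \<sigma> (Suc m) (2 * k + 1) = ?g 0 (offset_point \<sigma> m k)" for k
      unfolding offset_point_def offset_even offset_odd
      using False by (simp_all add: field_simps odd_iff_mod_2_eq_one mod_Suc)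
    then show ?thesis
      unfolding split unfolding hammersley_Suc Suc
      by (simp add: image_mset.compositionality comp_def del: power_Suc)
  qed
qed

section \<open>Moments of the signed offsets\<close>

text \<open>This is the t of the introductory sketch; the closed forms below depend on \<sigma>
  through it alone. Inside the inductions, \<open>t\<close> is instead the single new sign.\<close>

definition sign_sum :: "(nat \<Rightarrow> nat) \<Rightarrow> nat \<Rightarrow> real" where
  "sign_sum \<sigma> m = (\<Sum>j=1..m. (-1) ^ \<sigma> j)"

lemma sign_sum_0: "sign_sum \<sigma> 0 = 0"
  and sign_sum_Suc: "sign_sum \<sigma> (Suc m) = sign_sum \<sigma> m + (-1) ^ \<sigma> (Suc m)"
  by (simp_all add: sign_sum_def)

lemma sign_square: "((-1::real) ^ n)\<^sup>2 = 1"
  by (simp flip: power_mult)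

lemma sum_lessThan_power_Suc:
  fixes f :: "nat \<Rightarrow> real"
  shows "(\<Sum>k<2 ^ Suc m. f k) = (\<Sum>k<2 ^ m. f (2 * k) + f (2 * k + 1))"
  unfolding power_Suc by (rule sum_lessThan_double)

lemma sum_offset: "(\<Sum>k<2 ^ m. offset \<sigma> m k) = 0"
proof (induction m)
  case (Suc m)
  show ?case unfolding sum_lessThan_power_Suc offset_even offset_odd
    using Suc by (simp add: sum_distrib_left[symmetric])
qed simp

text \<open>The terms 2ktM cancel between siblings; the odd child leaves one tM for each k, so every
  level contributes its own sign.\<close>

lemma sum_offset_index: "(\<Sum>k<2 ^ m. real k * offset \<sigma> m k) = (2 ^ m)\<^sup>2 * sign_sum \<sigma> m / 4"
proof (induction m)
  case (Suc m)
  define t M :: real where "t = (-1) ^ \<sigma> (Suc m)" and "M = 2 ^ m"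
  have "(\<Sum>k<2 ^ Suc m. real k * offset \<sigma> (Suc m) k)
      = (\<Sum>k<2 ^ m. 4 * (real k * offset \<sigma> m k) + offset \<sigma> m k + t * M)"
    unfolding sum_lessThan_power_Suc offset_even offset_odd t_def M_def
    by (rule sum.cong) (auto simp: algebra_simps)
  also have "\<dots> = 4 * (M\<^sup>2 * sign_sum \<sigma> m / 4) + M * (t * M)"
    unfolding sum.distrib sum_distrib_left[symmetric] Suc sum_offset M_def by simp
  also have "\<dots> = (2 ^ Suc m)\<^sup>2 * sign_sum \<sigma> (Suc m) / 4"
    by (simp add: sign_sum_Suc t_def M_def field_simps power2_eq_square)
  finally show ?case .
qed (simp add: sign_sum_0)

lemma sum_offset_square: "(\<Sum>k<2 ^ m. (offset \<sigma> m k)\<^sup>2) = 2 ^ m * ((2 ^ m)\<^sup>2 - 1) / 3"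
proof (induction m)
  case (Suc m)
  define t M :: real where "t = (-1) ^ \<sigma> (Suc m)" and "M = 2 ^ m"
  have t2: "t\<^sup>2 = 1" by (simp add: t_def sign_square)
  have "(\<Sum>k<2 ^ Suc m. (offset \<sigma> (Suc m) k)\<^sup>2)
      = (\<Sum>k<2 ^ m. 2 * (offset \<sigma> m k)\<^sup>2 + 2 * M\<^sup>2)"
    unfolding sum_lessThan_power_Suc offset_even offset_odd t_def[symmetric] M_def[symmetric]
    by (rule sum.cong) (simp_all add: power2_sum power2_diff power_mult_distrib t2 algebra_simps)
  also have "\<dots> = 2 * (M * (M\<^sup>2 - 1) / 3) + M * (2 * M\<^sup>2)"
    unfolding sum.distrib sum_distrib_left[symmetric] Suc M_def by simp
  also have "\<dots> = 2 ^ Suc m * ((2 ^ Suc m)\<^sup>2 - 1) / 3"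
    by (simp add: M_def field_simps power2_eq_square)
  finally show ?case .
qed simp

text \<open>The new sign multiplies only the sum of the offsets, which vanishes; hence \<sigma> does
  not enter.\<close>

lemma sum_index_offset_square:
  "(\<Sum>k<2 ^ m. real k * (offset \<sigma> m k)\<^sup>2) = (2 ^ m - 1) * 2 ^ m * ((2 ^ m)\<^sup>2 - 1) / 6"
proof (induction m)
  case (Suc m)
  define t M :: real where "t = (-1) ^ \<sigma> (Suc m)" and "M = 2 ^ m"
  have t2: "t\<^sup>2 = 1" by (simp add: t_def sign_square)
  have "(\<Sum>k<2 ^ Suc m. real k * (offset \<sigma> (Suc m) k)\<^sup>2)
      = (\<Sum>k<2 ^ m. 4 * (real k * (offset \<sigma> m k)\<^sup>2) + (offset \<sigma> m k)\<^sup>2 + 4 * M\<^sup>2 * real k + M\<^sup>2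
          + 2 * t * M * offset \<sigma> m k)"
    unfolding sum_lessThan_power_Suc offset_even offset_odd t_def[symmetric] M_def[symmetric]
      of_nat_add of_nat_mult of_nat_numeral of_nat_1
    by (rule sum.cong) (simp_all add: power2_sum power2_diff power_mult_distrib t2 algebra_simps)
  also have "\<dots> = 4 * ((M - 1) * M * (M\<^sup>2 - 1) / 6) + M * (M\<^sup>2 - 1) / 3
      + 4 * M\<^sup>2 * (M * (M - 1) / 2) + M * M\<^sup>2"
    unfolding sum.distrib sum_distrib_left[symmetric] Suc sum_offset sum_offset_square sum_nat M_def
    by simp
  also have "\<dots> = (2 ^ Suc m - 1) * 2 ^ Suc m * ((2 ^ Suc m)\<^sup>2 - 1) / 6"
    by (simp add: M_def field_simps power2_eq_square)
  finally show ?case .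
qed simp

text \<open>With s the sign sum, the mixed term 8tN k W_k sums to 2tsN^3. This is the increment of
  N^3 (s^2 - m) when s becomes s+t and m becomes m+1, because t^2 = 1.\<close>

lemma sum_index_square_offset_square:
  fixes M :: real
  assumes "M = 2 ^ m"
  shows "(\<Sum>k<2 ^ m. (real k)\<^sup>2 * (offset \<sigma> m k)\<^sup>2) =
    M ^ 5 / 9 - M ^ 4 / 6 - M ^ 3 / 18 + M\<^sup>2 / 6 - M / 18 + M ^ 3 * ((sign_sum \<sigma> m)\<^sup>2 - real m) / 8"
  using assms
proof (induction m arbitrary: M)
  case (Suc m)
  define t N :: real where "t = (-1) ^ \<sigma> (Suc m)" and "N = 2 ^ m"
  have t2: "t\<^sup>2 = 1" by (simp add: t_def sign_square)
  have M: "M = 2 * N" by (simp add: N_def Suc.prems)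
  have "(\<Sum>k<2 ^ Suc m. (real k)\<^sup>2 * (offset \<sigma> (Suc m) k)\<^sup>2)
      = (\<Sum>k<2 ^ m. 8 * ((real k)\<^sup>2 * (offset \<sigma> m k)\<^sup>2) + 4 * (real k * (offset \<sigma> m k)\<^sup>2)
          + (offset \<sigma> m k)\<^sup>2 + 8 * N\<^sup>2 * (real k)\<^sup>2 + 4 * N\<^sup>2 * real k + N\<^sup>2
          + 8 * t * N * (real k * offset \<sigma> m k) + 2 * t * N * offset \<sigma> m k)"
    unfolding sum_lessThan_power_Suc offset_even offset_odd t_def[symmetric] N_def[symmetric]
      of_nat_add of_nat_mult of_nat_numeral of_nat_1
    by (rule sum.cong) (simp_all add: power2_sum power2_diff power_mult_distrib t2 algebra_simps)
  also have "\<dots> = 8 * (N ^ 5 / 9 - N ^ 4 / 6 - N ^ 3 / 18 + N\<^sup>2 / 6 - N / 18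
          + N ^ 3 * ((sign_sum \<sigma> m)\<^sup>2 - real m) / 8)
      + 4 * ((N - 1) * N * (N\<^sup>2 - 1) / 6) + N * (N\<^sup>2 - 1) / 3
      + 8 * N\<^sup>2 * (N * (N - 1) * (2 * N - 1) / 6) + 4 * N\<^sup>2 * (N * (N - 1) / 2) + N * N\<^sup>2
      + 8 * t * N * (N\<^sup>2 * sign_sum \<sigma> m / 4)"
    unfolding sum.distrib sum_distrib_left[symmetric] Suc.IH[OF N_def] sum_offset sum_offset_square
      sum_index_offset_square sum_offset_index sum_nat sum_nat_squares 
    by (simp add: N_def)
  also have "\<dots> = M ^ 5 / 9 - M ^ 4 / 6 - M ^ 3 / 18 + M\<^sup>2 / 6 - M / 18
      + M ^ 3 * ((sign_sum \<sigma> m + t)\<^sup>2 - real (Suc m)) / 8"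
    unfolding M using t2 by (simp add: field_simps eval_nat_numeral)
  finally show ?case unfolding sign_sum_Suc t_def .
qed (simp add: sign_sum_0)

section \<open>Absolute offsets and sums of maxima over pairs\<close>

text \<open>The absolute values of two siblings add up to 2 * 2^m. The pattern starts at level one:
  at level zero the only offset is 0, whereas half the squared number of indices is 1/2.\<close>

lemma sum_abs_offset: "(\<Sum>k<2 ^ Suc m. \<bar>offset \<sigma> (Suc m) k\<bar>) = 2 * (2 ^ m)\<^sup>2"
  unfolding sum_lessThan_power_Suc abs_offset_even abs_offset_odd
  by (simp add: power2_eq_square)

text \<open>If |v| is at least |w|, the two maxima containing M+|v| equal it, and the other two are
  M+w and M-w. The parent maximum of absolute values reappears, which closes the recursion.\<close>

lemma sum_max_children:
  fixes t M v w :: real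
  assumes "t = 1 \<or> t = -1"
  shows "max (M - t * v) (M - t * w) + max (M - t * v) (M + t * w)
    + max (M + t * v) (M - t * w) + max (M + t * v) (M + t * w) = 4 * M + 2 * max \<bar>v\<bar> \<bar>w\<bar>"
  using assms by (auto simp: max_def abs_if)

lemma sum_max_abs_offset:
  fixes M :: real
  assumes "M = 2 ^ m"
  shows "(\<Sum>k<2 ^ m. \<Sum>l<2 ^ m. max \<bar>offset \<sigma> m k\<bar> \<bar>offset \<sigma> m l\<bar>) = 2 / 3 * (M ^ 3 - M)"
  using assms
proof (induction m arbitrary: M)
  case (Suc m)
  define t N :: real where "t = (-1) ^ \<sigma> (Suc m)" and "N = 2 ^ m"
  have t: "t = 1 \<or> t = -1" unfolding t_def by (cases "even (\<sigma> (Suc m))") auto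
  have "(\<Sum>k<2 ^ Suc m. \<Sum>l<2 ^ Suc m. max \<bar>offset \<sigma> (Suc m) k\<bar> \<bar>offset \<sigma> (Suc m) l\<bar>)
    = (\<Sum>k<2 ^ m. \<Sum>l<2 ^ m. 4 * N + 2 * max \<bar>offset \<sigma> m k\<bar> \<bar>offset \<sigma> m l\<bar>)"
    unfolding power_Suc[of "2::nat"] sum_sum_lessThan_double abs_offset_even abs_offset_odd
      t_def[symmetric] N_def[symmetric] sum_max_children[OF t] ..
  also have "\<dots> = N * (N * (4 * N)) + 2 * (2 / 3 * (N ^ 3 - N))"
    unfolding sum.distrib sum_distrib_left[symmetric] Suc.IH[OF N_def] by (simp add: N_def)
  also have "\<dots> = 2 / 3 * (M ^ 3 - M)"
    by (simp add: N_def Suc.prems power3_eq_cube field_simps)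
  finally show ?case .
qed simp

text \<open>Each child pair has maximal index 2 max(k,l) or one more. The common part multiplies all
  four maxima, where \<open>sum_max_children\<close> applies. The extra 1 occurs when an odd child
  attains the maximum: for two of the four terms off the diagonal and for three on it, whence the
  correction at k = l.\<close>

lemma sum_max_max_children:
  fixes t M :: real and W :: "nat \<Rightarrow> real" and k l :: nat
  assumes t: "t = 1 \<or> t = -1"
  shows "max (M - t * W k) (M - t * W l) * real (max (2 * k) (2 * l))
    + max (M - t * W k) (M + t * W l) * real (max (2 * k) (2 * l + 1))
    + max (M + t * W k) (M - t * W l) * real (max (2 * k + 1) (2 * l))
    + max (M + t * W k) (M + t * W l) * real (max (2 * k + 1) (2 * l + 1))
    = 8 * M * real (max k l) + 4 * (max \<bar>W k\<bar> \<bar>W l\<bar> * real (max k l)) + 2 * M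
      + max \<bar>W k\<bar> \<bar>W l\<bar> + t * W (max k l) + (if k = l then M + \<bar>W k\<bar> else 0)"
proof -
  define a b c d where "a = max (M - t * W k) (M - t * W l)" and "b = max (M - t * W k) (M + t * W l)"
    and "c = max (M + t * W k) (M - t * W l)" and "d = max (M + t * W k) (M + t * W l)"
  have abcd: "a + b + c + d = 4 * M + 2 * max \<bar>W k\<bar> \<bar>W l\<bar>"
    unfolding a_def b_def c_def d_def by (rule sum_max_children[OF t])
  define X where "X = max \<bar>W k\<bar> \<bar>W l\<bar>"
  consider "k < l" | "l < k" | "k = l" by linarith
  then have "a * real (max (2 * k) (2 * l)) + b * real (max (2 * k) (2 * l + 1))
    + c * real (max (2 * k + 1) (2 * l)) + d * real (max (2 * k + 1) (2 * l + 1))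
    = 2 * real (max k l) * (a + b + c + d) + (2 * M + X + t * W (max k l)
      + (if k = l then M + \<bar>W k\<bar> else 0))"
  proof cases
    case 1
    have "b + d = 2 * M + X + t * W l"
      unfolding b_def d_def X_def using t by (auto simp: max_def abs_if)
    \<comment> \<open>Eliminating \<open>d\<close> leaves a polynomial identity in which the
      remaining maxima are opaque.\<close>
    then have d: "d = 2 * M + X + t * W l - b" by simp
    show ?thesis unfolding d using 1 by (simp add: max_def algebra_simps)
  next
    case 2
    have "c + d = 2 * M + X + t * W k"
      unfolding c_def d_def X_def using t by (auto simp: max_def abs_if)
    then have d: "d = 2 * M + X + t * W k - c" by simp
    show ?thesis unfolding d using 2 by (simp add: max_def algebra_simps)
  next
    case 3
    then have "b + c + d = 2 * M + X + t * W k + (M + \<bar>W k\<bar>)"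
      unfolding b_def c_def d_def X_def using t by (auto simp: max_def abs_if)
    then have d: "d = 2 * M + X + t * W k + (M + \<bar>W k\<bar>) - b - c" by simp
    show ?thesis unfolding d using 3 by (simp add: max_def algebra_simps)
  qed
  then show ?thesis
    unfolding abcd unfolding a_def b_def c_def d_def X_def by (simp add: algebra_simps)
qed

text \<open>The induction starts at level one because the diagonal correction uses
  \<open>sum_abs_offset\<close>; at level zero the right-hand side would be -1/8 instead of
  0.\<close>

lemma sum_max_abs_offset_max_index:
  fixes M :: real
  assumes "M = 2 ^ Suc m"
  shows "(\<Sum>k<2 ^ Suc m. \<Sum>l<2 ^ Suc m.
      max \<bar>offset \<sigma> (Suc m) k\<bar> \<bar>offset \<sigma> (Suc m) l\<bar> * real (max k l)) =
    4 / 9 * M ^ 4 - M ^ 3 / 3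
    + M\<^sup>2 * (real (Suc m) / 24 + ((sign_sum \<sigma> (Suc m))\<^sup>2 - real (Suc m)) / 16 - 41 / 72) + M / 3"
  using assms
proof (induction m arbitrary: M)
  case 0
  show ?case
    by (simp add: 0 sign_sum_Suc sign_sum_0 sign_square numeral_2_eq_2 power_abs max_def)
next
  case (Suc m)
  \<comment> \<open>Hiding the inner successor ensures that only the outermost level is split by the
    unfoldings.\<close>
  define n where "n = Suc m"
  define t N :: real where "t = (-1) ^ \<sigma> (Suc n)" and "N = 2 ^ n"
  have t: "t = 1 \<or> t = -1" unfolding t_def by (cases "even (\<sigma> (Suc n))") auto
  have t2: "t\<^sup>2 = 1" by (simp add: t_def sign_square)
  have M: "M = 2 * N" by (simp add: N_def n_def Suc.prems)
  have offset_max: "(\<Sum>k<2 ^ n. \<Sum>l<2 ^ n. offset \<sigma> n (max k l)) = N\<^sup>2 * sign_sum \<sigma> n / 2"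
  proof -
    have "(\<Sum>k<2 ^ n. (2 * real k + 1) * offset \<sigma> n k)
        = (\<Sum>k<2 ^ n. 2 * (real k * offset \<sigma> n k) + offset \<sigma> n k)"
      by (simp add: algebra_simps)
    also have "\<dots> = 2 * (N\<^sup>2 * sign_sum \<sigma> n / 4)"
      unfolding sum.distrib sum_distrib_left[symmetric] sum_offset_index sum_offset N_def by simp
    finally show ?thesis unfolding sum_sum_at_max by simp
  qed
  have diagonal: "(\<Sum>k<2 ^ n. N + \<bar>offset \<sigma> n k\<bar>) = N\<^sup>2 + N\<^sup>2 / 2"
    unfolding sum.distrib n_def sum_abs_offset by (simp add: N_def n_def power2_eq_square)
  have "(\<Sum>k<2 ^ Suc n. \<Sum>l<2 ^ Suc n.
      max \<bar>offset \<sigma> (Suc n) k\<bar> \<bar>offset \<sigma> (Suc n) l\<bar> * real (max k l))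
    = (\<Sum>k<2 ^ n. \<Sum>l<2 ^ n. 8 * N * real (max k l)
      + 4 * (max \<bar>offset \<sigma> n k\<bar> \<bar>offset \<sigma> n l\<bar> * real (max k l)) + 2 * N
      + max \<bar>offset \<sigma> n k\<bar> \<bar>offset \<sigma> n l\<bar> + t * offset \<sigma> n (max k l)
      + (if k = l then N + \<bar>offset \<sigma> n k\<bar> else 0))"
    unfolding power_Suc[of "2::nat"] sum_sum_lessThan_double abs_offset_even abs_offset_odd
      t_def[symmetric] N_def[symmetric] sum_max_max_children[OF t, of N "offset \<sigma> n"] ..
  also have "\<dots> = 8 * N * (N * (N - 1) * (4 * N + 1) / 6)
    + 4 * (4 / 9 * N ^ 4 - N ^ 3 / 3
      + N\<^sup>2 * (real n / 24 + ((sign_sum \<sigma> n)\<^sup>2 - real n) / 16 - 41 / 72) + N / 3)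
    + N * (N * (2 * N)) + 2 / 3 * (N ^ 3 - N) + t * (N\<^sup>2 * sign_sum \<sigma> n / 2) + (N\<^sup>2 + N\<^sup>2 / 2)"
    unfolding sum.distrib sum_distrib_left[symmetric] sum_max_index offset_max 
      Suc.IH[OF N_def[unfolded n_def], folded n_def] sum_max_abs_offset[OF N_def]
    using diagonal by (simp add: N_def sum.delta)
  \<comment> \<open>The term -4/3 N^2 from the index sum and 3/2 N^2 from \<open>diagonal\<close>
    leave N^2/6 = M^2/24, the source of m/24. With s the old sign sum, tsN^2/2 = 2ts M^2/16
    completes the square.\<close>
  also have "\<dots> = 4 / 9 * M ^ 4 - M ^ 3 / 3
    + M\<^sup>2 * (real (Suc n) / 24 + ((sign_sum \<sigma> n + t)\<^sup>2 - real (Suc n)) / 16 - 41 / 72) + M / 3"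
    unfolding M using t2 by (simp add: field_simps eval_nat_numeral)
  finally show ?case unfolding n_def sign_sum_Suc[of \<sigma> "Suc m"] t_def .
qed

section \<open>The symmetrized set in Warnock's formula\<close>

lemma offset_point_bounds:
  assumes "k < 2 ^ m"
  shows "0 \<le> fst (offset_point \<sigma> m k) \<and> fst (offset_point \<sigma> m k) \<le> 1
    \<and> 0 \<le> snd (offset_point \<sigma> m k) \<and> snd (offset_point \<sigma> m k) \<le> 1"
proof -
  have "real k \<le> 2 ^ m" using assms by (metis less_imp_le of_nat_le_iff of_nat_numeral of_nat_power)
  moreover have "\<bar>offset \<sigma> m k\<bar> \<le> 2 ^ m - 1" by (rule abs_offset_le)
  ultimately show ?thesis by (auto simp: offset_point_def field_simps abs_le_iff)
qed

lemma sum_mset_hammersley_sym: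
  "(\<Sum>z\<in>#hammersley_sym m \<sigma>. f z) =
    (\<Sum>k<2 ^ m. f (offset_point \<sigma> m k) + f (offset_point (sigma_star \<sigma>) m k))"
  for f :: "_ \<Rightarrow> real"
  unfolding hammersley_sym_def hammersley_eq_offset
  by (simp add: image_mset.compositionality comp_def sum.distrib sum_unfold_sum_mset)

lemma size_hammersley_sym: "size (hammersley_sym m \<sigma>) = 2 ^ (m + 1)"
  by (simp add: hammersley_sym_def hammersley_eq_offset)

lemma hammersley_sym_bounds:
  assumes "(x, y) \<in># hammersley_sym m \<sigma>"
  shows "0 \<le> x \<and> x \<le> 1 \<and> 0 \<le> y \<and> y \<le> 1"
proof -
  obtain k \<tau> where "k < 2 ^ m" "(x, y) = offset_point \<tau> m k"
    using assms by (auto simp: hammersley_sym_def hammersley_eq_offset)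
  then show ?thesis using offset_point_bounds[of k m \<tau>] by (metis fst_conv snd_conv)
qed

text \<open>The four-sign identity for mirror pairs on two ordinates: symmetrization leaves only
  absolute offsets in the pair sum.\<close>

lemma sum_max_shifted_signs:
  fixes c v w :: real
  shows "(1 - max (c + v) (c + w)) + (1 - max (c + v) (c - w))
    + ((1 - max (c - v) (c + w)) + (1 - max (c - v) (c - w))) = 4 - 4 * c - 2 * max \<bar>v\<bar> \<bar>w\<bar>"
  by (simp add: max_def abs_if)

text \<open>Mirror points share their ordinate, so the abscissa factors can be added first. For
  pairs, 4 - 4c = 2 + 2/M; for single points, the squares of c+v and c-v add up to 2c^2 +
  2v^2.\<close>

lemma integral_local_discrepancy_hammersley_sym:
  fixes M :: real
  assumes M: "M = 2 ^ m"
  shows "integral (cbox (0, 0) (1, 1)) (\<lambda>(\<alpha>, \<beta>). \<bar>local_discrepancy \<alpha> \<beta> (hammersley_sym m \<sigma>)\<bar> ^ 2) =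
    (\<Sum>k<2 ^ m. \<Sum>l<2 ^ m. (2 + 2 / M - max \<bar>offset \<sigma> m k\<bar> \<bar>offset \<sigma> m l\<bar> / M) * (1 - real (max k l) / M))
    - M * (\<Sum>k<2 ^ m. (2 - (1 - 1 / M)\<^sup>2 / 2 - (offset \<sigma> m k)\<^sup>2 / (2 * M\<^sup>2)) * (1 - (real k)\<^sup>2 / M\<^sup>2))
    + 4 * M\<^sup>2 / 9"
proof -
  have "M > 0" by (simp add: M)
  define c where "c = (1 - 1 / M) / 2"
  define v where "v k = offset \<sigma> m k / (2 * M)" for k
  have pt: "offset_point \<sigma> m k = (c + v k, real k / M)"
    and pt_star: "offset_point (sigma_star \<sigma>) m k = (c - v k, real k / M)" for k
    by (simp_all add: offset_point_def offset_sigma_star c_def v_def M)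
  have max_div: "max (a / M) (b / M) = max a b / M" for a b
    using \<open>M > 0\<close> by (simp add: max_def divide_le_cancel)
  have abs_v: "max \<bar>v k\<bar> \<bar>v l\<bar> = max \<bar>offset \<sigma> m k\<bar> \<bar>offset \<sigma> m l\<bar> / (2 * M)" for k l
    using \<open>M > 0\<close> by (simp add: v_def max_def abs_mult divide_le_cancel)
  have "(\<Sum>z\<in>#hammersley_sym m \<sigma>. \<Sum>w\<in>#hammersley_sym m \<sigma>.
        (1 - max (fst z) (fst w)) * (1 - max (snd z) (snd w)))
    = (\<Sum>k<2 ^ m. \<Sum>l<2 ^ m. ((1 - max (c + v k) (c + v l)) + (1 - max (c + v k) (c - v l))
      + ((1 - max (c - v k) (c + v l)) + (1 - max (c - v k) (c - v l)))) * (1 - max (real k / M) (real l / M)))"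
    unfolding sum_mset_hammersley_sym pt pt_star fst_conv snd_conv
    by (simp only: distrib_right sum.distrib)
  also have "\<dots> = (\<Sum>k<2 ^ m. \<Sum>l<2 ^ m.
      (2 + 2 / M - max \<bar>offset \<sigma> m k\<bar> \<bar>offset \<sigma> m l\<bar> / M) * (1 - real (max k l) / M))"
    unfolding sum_max_shifted_signs abs_v max_div c_def of_nat_max
    using \<open>M > 0\<close> by (intro sum.cong refl) (simp add: field_simps)
  finally have pairs: "(\<Sum>z\<in>#hammersley_sym m \<sigma>. \<Sum>w\<in>#hammersley_sym m \<sigma>.
        (1 - max (fst z) (fst w)) * (1 - max (snd z) (snd w))) = \<dots>" .
  have "(\<Sum>z\<in>#hammersley_sym m \<sigma>. (1 - (fst z)\<^sup>2) * (1 - (snd z)\<^sup>2))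
    = (\<Sum>k<2 ^ m. (2 - 2 * c\<^sup>2 - 2 * (v k)\<^sup>2) * (1 - (real k / M)\<^sup>2))"
    unfolding sum_mset_hammersley_sym pt pt_star fst_conv snd_conv
    using \<open>M > 0\<close> by (intro sum.cong refl) (simp add: field_simps power2_eq_square)
  also have "\<dots> = (\<Sum>k<2 ^ m. (2 - (1 - 1 / M)\<^sup>2 / 2 - (offset \<sigma> m k)\<^sup>2 / (2 * M\<^sup>2)) * (1 - (real k)\<^sup>2 / M\<^sup>2))"
    by (simp add: c_def v_def power_divide power_mult_distrib)
  finally have singles: "(\<Sum>z\<in>#hammersley_sym m \<sigma>. (1 - (fst z)\<^sup>2) * (1 - (snd z)\<^sup>2)) = \<dots>" .
  have size: "real (size (hammersley_sym m \<sigma>)) = 2 * M"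
    by (simp add: size_hammersley_sym M)
  have eq: "integral (cbox (0, 0) (1, 1)) (\<lambda>(\<alpha>, \<beta>). \<bar>local_discrepancy \<alpha> \<beta> (hammersley_sym m \<sigma>)\<bar> ^ 2) =
    (\<Sum>z\<in>#hammersley_sym m \<sigma>. \<Sum>w\<in>#hammersley_sym m \<sigma>.
      (1 - max (fst z) (fst w)) * (1 - max (snd z) (snd w)))
    - real (size (hammersley_sym m \<sigma>)) / 2 * (\<Sum>z\<in>#hammersley_sym m \<sigma>. (1 - (fst z)\<^sup>2) * (1 - (snd z)\<^sup>2))
    + (real (size (hammersley_sym m \<sigma>)))\<^sup>2 / 9"
    by (rule warnock) (rule hammersley_sym_bounds)
  show ?thesis unfolding eq pairs singles size by (simp add: power_mult_distrib)
qed

section \<open>Evaluation of the discrepancy\<close>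

theorem theorem1:
  fixes m :: nat and \<sigma> :: "nat \<Rightarrow> nat"
  assumes "m \<ge> 1"
    and "\<forall>j\<in>{1..m}. \<sigma> j \<in> {0, 1}"
  shows "(2 ^ (m + 1) * L2_discrepancy (hammersley_sym m \<sigma>)) ^ 2
           = real m / 24 + 11 / 8 + 1 / 2 ^ m - 1 / (9 * 2 ^ (2 * m + 1))"
proof -
  define M :: real where "M = 2 ^ m"
  have "M > 0" by (simp add: M_def)
  obtain n where m: "m = Suc n" using assms(1) by (cases m) auto
  \<comment> \<open>Here \<open>d\<close> stands for the squared sign sum minus m. It is left
    arbitrary, and d/16 appears in both \<open>pairs\<close> and \<open>singles\<close>, so it
    cancels in their difference.\<close>
  have pairs: "M * (M * (2 + 2 / M)) - (2 + 2 / M) / M * (M * (M - 1) * (4 * M + 1) / 6)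
      - 1 / M * (2 / 3 * (M ^ 3 - M))
      + 1 / M\<^sup>2 * (4 / 9 * M ^ 4 - M ^ 3 / 3 + M\<^sup>2 * (real m / 24 + d / 16 - 41 / 72) + M / 3)
    = 4 / 9 * M\<^sup>2 + 4 / 3 * M + 103 / 72 + (real m / 24 + d / 16) + 2 / (3 * M)" for d
    using \<open>M > 0\<close> by (simp add: field_simps eval_nat_numeral)
  have singles: "M * (M * (2 - (1 - 1 / M)\<^sup>2 / 2)
      - (2 - (1 - 1 / M)\<^sup>2 / 2) / M\<^sup>2 * (M * (M - 1) * (2 * M - 1) / 6)
      - 1 / (2 * M\<^sup>2) * (M * (M\<^sup>2 - 1) / 3)
      + 1 / (2 * M ^ 4) * (M ^ 5 / 9 - M ^ 4 / 6 - M ^ 3 / 18 + M\<^sup>2 / 6 - M / 18 + M ^ 3 * d / 8))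
    = 8 / 9 * M\<^sup>2 + 4 / 3 * M + 1 / 18 + d / 16 - 1 / (3 * M) + 1 / (18 * M\<^sup>2)" for d
    using \<open>M > 0\<close> by (simp add: field_simps eval_nat_numeral)
  let ?P = "hammersley_sym m \<sigma>"
  let ?I = "integral (cbox (0, 0) (1, 1)) (\<lambda>(\<alpha>, \<beta>). \<bar>local_discrepancy \<alpha> \<beta> ?P\<bar> ^ 2)"
  let ?d = "(sign_sum \<sigma> m)\<^sup>2 - real m"
  \<comment> \<open>Nonnegativity undoes the square root in \<open>L2_discrepancy\<close>; a
    non-integrable function would have integral 0 by convention.\<close>
  have "?I \<ge> 0"
    by (cases "(\<lambda>(\<alpha>, \<beta>). \<bar>local_discrepancy \<alpha> \<beta> ?P\<bar> ^ 2) integrable_on cbox (0, 0) (1, 1)")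
      (auto intro!: integral_nonneg simp: not_integrable_integral)
  then have "(2 ^ (m + 1) * L2_discrepancy ?P) ^ 2 = ?I"
    by (simp add: L2_discrepancy_def size_hammersley_sym)
  also have "\<dots> = (\<Sum>k<2 ^ m. \<Sum>l<2 ^ m.
        (2 + 2 / M - max \<bar>offset \<sigma> m k\<bar> \<bar>offset \<sigma> m l\<bar> / M) * (1 - real (max k l) / M))
      - M * (\<Sum>k<2 ^ m. (2 - (1 - 1 / M)\<^sup>2 / 2 - (offset \<sigma> m k)\<^sup>2 / (2 * M\<^sup>2)) * (1 - (real k)\<^sup>2 / M\<^sup>2))
      + 4 * M\<^sup>2 / 9"
    by (rule integral_local_discrepancy_hammersley_sym) (rule M_def)
  also have "(\<Sum>k<2 ^ m. \<Sum>l<2 ^ m.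
        (2 + 2 / M - max \<bar>offset \<sigma> m k\<bar> \<bar>offset \<sigma> m l\<bar> / M) * (1 - real (max k l) / M))
    = (\<Sum>k<2 ^ m. \<Sum>l<2 ^ m. (2 + 2 / M) - (2 + 2 / M) / M * real (max k l)
        - 1 / M * max \<bar>offset \<sigma> m k\<bar> \<bar>offset \<sigma> m l\<bar>
        + 1 / M\<^sup>2 * (max \<bar>offset \<sigma> m k\<bar> \<bar>offset \<sigma> m l\<bar> * real (max k l)))"
    using \<open>M > 0\<close> by (intro sum.cong refl) (simp add: field_simps power2_eq_square)
  also have "\<dots> = M * (M * (2 + 2 / M)) - (2 + 2 / M) / M * (M * (M - 1) * (4 * M + 1) / 6)
      - 1 / M * (2 / 3 * (M ^ 3 - M))
      + 1 / M\<^sup>2 * (4 / 9 * M ^ 4 - M ^ 3 / 3 + M\<^sup>2 * (real m / 24 + ?d / 16 - 41 / 72) + M / 3)"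
    unfolding sum.distrib sum_subtractf sum_distrib_left[symmetric] sum_max_index
      sum_max_abs_offset[OF M_def]
      sum_max_abs_offset_max_index[OF M_def[unfolded m], folded m]
    by (simp add: M_def distrib_left)
  also have "(\<Sum>k<2 ^ m. (2 - (1 - 1 / M)\<^sup>2 / 2 - (offset \<sigma> m k)\<^sup>2 / (2 * M\<^sup>2)) * (1 - (real k)\<^sup>2 / M\<^sup>2))
    = (\<Sum>k<2 ^ m. (2 - (1 - 1 / M)\<^sup>2 / 2) - (2 - (1 - 1 / M)\<^sup>2 / 2) / M\<^sup>2 * (real k)\<^sup>2
        - 1 / (2 * M\<^sup>2) * (offset \<sigma> m k)\<^sup>2 + 1 / (2 * M ^ 4) * ((real k)\<^sup>2 * (offset \<sigma> m k)\<^sup>2))"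
    using \<open>M > 0\<close> by (intro sum.cong refl) (simp add: field_simps power2_eq_square power4_eq_xxxx)
  also have "\<dots> = M * (2 - (1 - 1 / M)\<^sup>2 / 2)
      - (2 - (1 - 1 / M)\<^sup>2 / 2) / M\<^sup>2 * (M * (M - 1) * (2 * M - 1) / 6)
      - 1 / (2 * M\<^sup>2) * (M * (M\<^sup>2 - 1) / 3)
      + 1 / (2 * M ^ 4) * (M ^ 5 / 9 - M ^ 4 / 6 - M ^ 3 / 18 + M\<^sup>2 / 6 - M / 18 + M ^ 3 * ?d / 8)"
    unfolding sum.distrib sum_subtractf sum_distrib_left[symmetric] sum_nat_squares
      sum_offset_square sum_index_square_offset_square[OF M_def]
    by (simp add: M_def right_diff_distrib)
  also have "M * (\<dots>) = 8 / 9 * M\<^sup>2 + 4 / 3 * M + 1 / 18 + ?d / 16 - 1 / (3 * M) + 1 / (18 * M\<^sup>2)"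
    by (rule singles)
  \<comment> \<open>The M^2 terms cancel as 4/9 - 8/9 + 4/9 = 0, the linear terms cancel, and the
    constants give 103/72 - 1/18 = 11/8.\<close>
  finally have "(2 ^ (m + 1) * L2_discrepancy ?P) ^ 2 = real m / 24 + 11 / 8 + 1 / M - 1 / (9 * (2 * M\<^sup>2))"
    unfolding pairs by (simp add: field_simps)
  moreover have "(2::real) ^ (2 * m + 1) = 2 * M\<^sup>2"
    by (simp add: M_def power_even_eq)
  ultimately show ?thesis by (simp only: M_def)
qed

end
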